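(* Let $H$ be a 3-uniform marked hyperforest that is not a trivial Maker win, with $|V(H)\setminus M(H)|\ge2$. Then $H$ is a Breaker win if and only if $J_1(\mathcal S,H)$ holds.
   Context: A marked hypergraph $H$: finite nonempty $V(H)$, edge set $E(H)$ of nonempty subsets of $V(H)$, marked set $M(H)\subseteq V(H)$; 3-uniform: all edges of size 3. Subhypergraph $X$: $V(X)\subseteq V(H)$, $E(X)\subseteq E(H)$, $M(X)=V(X)\cap M(H)$. $H^{+x}$ marks non-marked $x$; $H^{-y}$ deletes $y$ and all edges containing it. Trivial Maker win: some edge $e$ with $|e\setminus M(H)|\le1$. Maker win (recursive): if $|V(H)\setminus M(H)|\le1$, iff trivial Maker win; otherwise iff some non-marked $x$ has $H^{+x-y}$ a Maker win for all non-marked $y\ne x$; otherwise Breaker win. $ab$-path of length $L\ge1$: edges $e_1,\dots,e_L$ (3-sets), vertex set $\bigcup e_i$, $|e_i\cap e_{i+1}|=1$, $e_i\cap e_j=\varnothing$ for $|i-j|\ge2$, $a\ne b$, $a\in e_1\setminus\bigcup_{i\ge2}e_i$, $b\in e_L\setminus\bigcup_{i<L}e_i$. $a$-cycle of length $L\ge2$: edges $e_1,\dots,e_L$, vertex set $\bigcup e_i$, $a\in e_1\cap e_L$, $a\notin e_i$ for $1<i<L$; if $L=2$, $|e_1\cap e_2|=2$; if $L\ge3$, $|e_i\cap e_{i+1}|=1$, $e_1\cap e_L=\{a\}$, other pairs with $|i-j|\ge2$ disjoint. A 3-uniform marked hyperforest contains no cycle. An $x$-snake is an $xm$-path of positive length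 with $m$ marked. $\mathcal S$: all pointed marked hypergraphs $(S,x)$ ($x$ non-marked) with $S$ an $x$-snake having exactly one marked vertex. $x\mathcal S(H)$: subhypergraphs $X\ni x$ of $H$ with $(X,x)$ isomorphic (bijection preserving edges, marks, point) to a member of $\mathcal S$. $\mathrm{Int}_H(\mathcal X)$: non-marked vertices of $H$ lying in every member of $\mathcal X$. $J_1(\mathcal S,H)$: for every $x\in V(H)\setminus M(H)$, $\mathrm{Int}_{H^{+x}}(x\mathcal S(H))\ne\varnothing$. *)

theory Defs
  imports Main
begin

record 'a marked_hypergraph =
  verts :: "'a set"
  edges :: "'a set set"
  marks :: "'a set"

definition is_marked_hypergraph :: "'a marked_hypergraph \<Rightarrow> bool" where
  "is_marked_hypergraph H \<longleftrightarrow>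
     finite (verts H) \<and> verts H \<noteq> {} \<and>
     (\<forall>e\<in>edges H. e \<noteq> {} \<and> e \<subseteq> verts H) \<and>
     marks H \<subseteq> verts H"

definition three_uniform :: "'a marked_hypergraph \<Rightarrow> bool" where
  "three_uniform H \<longleftrightarrow> (\<forall>e\<in>edges H. card e = 3)"

definition subhypergraph :: "'a marked_hypergraph \<Rightarrow> 'a marked_hypergraph \<Rightarrow> bool" where
  "subhypergraph X H \<longleftrightarrow>
     is_marked_hypergraph X \<and> verts X \<subseteq> verts H \<and> edges X \<subseteq> edges H \<and>
     marks X = verts X \<inter> marks H"

definition nonmarked :: "'a marked_hypergraph \<Rightarrow> 'a set" where
  "nonmarked H = verts H - marks H"

definition mark_vertex :: "'a marked_hypergraph \<Rightarrow> 'a \<Rightarrow> 'a marked_hypergraph" where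
  "mark_vertex H x = H\<lparr>marks := insert x (marks H)\<rparr>"

definition delete_vertex :: "'a marked_hypergraph \<Rightarrow> 'a \<Rightarrow> 'a marked_hypergraph" where
  "delete_vertex H y =
     \<lparr>verts = verts H - {y}, edges = {e \<in> edges H. y \<notin> e}, marks = marks H - {y}\<rparr>"

definition trivial_maker_win :: "'a marked_hypergraph \<Rightarrow> bool" where
  "trivial_maker_win H \<longleftrightarrow> (\<exists>e\<in>edges H. card (e - marks H) \<le> 1)"

function maker_win :: "'a marked_hypergraph \<Rightarrow> bool" where
  "maker_win H \<longleftrightarrow>
     (if card (nonmarked H) \<le> 1 then trivial_maker_win H
      else \<exists>x\<in>nonmarked H. \<forall>y\<in>nonmarked H - {x}.
             maker_win (delete_vertex (mark_vertex H x) y))"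
  by pat_completeness auto
termination
proof (relation "measure (\<lambda>H. card (nonmarked H))")
  fix H :: "'a marked_hypergraph" and x y
  assume big: "\<not> card (nonmarked H) \<le> 1" and x: "x \<in> nonmarked H"
  have fin: "finite (nonmarked H)"
    using big card.infinite by fastforce
  have "nonmarked (delete_vertex (mark_vertex H x) y) \<subset> nonmarked H"
    using x by (auto simp: nonmarked_def delete_vertex_def mark_vertex_def)
  then show "(delete_vertex (mark_vertex H x) y, H) \<in> measure (\<lambda>H. card (nonmarked H))"
    using fin by (simp add: psubset_card_mono)
qed simp

declare maker_win.simps [simp del]

definition breaker_win :: "'a marked_hypergraph \<Rightarrow> bool" where
  "breaker_win H \<longleftrightarrow> \<not> maker_win H"

text \<open>
  Paths and cycles are themselves marked hypergraphs, with an arbitrary set of marked vertices.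
  The edges \<open>e\<^sub>1, \<dots>, e\<^sub>L\<close> are the list entries \<open>es ! 0, \<dots>, es ! (L - 1)\<close>.
\<close>

definition is_path :: "'a \<Rightarrow> 'a \<Rightarrow> 'a marked_hypergraph \<Rightarrow> bool" where
  "is_path a b P \<longleftrightarrow>
     is_marked_hypergraph P \<and>
     (\<exists>es. length es \<ge> 1 \<and> edges P = set es \<and> verts P = \<Union> (set es) \<and>
        (\<forall>e\<in>set es. card e = 3) \<and>
        (\<forall>i. i + 1 < length es \<longrightarrow> card (es ! i \<inter> es ! (i + 1)) = 1) \<and>
        (\<forall>i j. i + 2 \<le> j \<and> j < length es \<longrightarrow> es ! i \<inter> es ! j = {}) \<and>
        a \<noteq> b \<and>
        a \<in> es ! 0 \<and> (\<forall>i. 0 < i \<and> i < length es \<longrightarrow> a \<notin> es ! i) \<and>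
        b \<in> es ! (length es - 1) \<and> (\<forall>i. i < length es - 1 \<longrightarrow> b \<notin> es ! i))"

definition is_cycle :: "'a \<Rightarrow> 'a marked_hypergraph \<Rightarrow> bool" where
  "is_cycle a C \<longleftrightarrow>
     is_marked_hypergraph C \<and>
     (\<exists>es. length es \<ge> 2 \<and> edges C = set es \<and> verts C = \<Union> (set es) \<and>
        (\<forall>e\<in>set es. card e = 3) \<and>
        a \<in> es ! 0 \<inter> es ! (length es - 1) \<and>
        (\<forall>i. 0 < i \<and> i < length es - 1 \<longrightarrow> a \<notin> es ! i) \<and>
        (length es = 2 \<longrightarrow> card (es ! 0 \<inter> es ! 1) = 2) \<and>
        (length es \<ge> 3 \<longrightarrow>
           (\<forall>i. i + 1 < length es \<longrightarrow> card (es ! i \<inter> es ! (i + 1)) = 1) \<and>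
           es ! 0 \<inter> es ! (length es - 1) = {a} \<and>
           (\<forall>i j. i + 2 \<le> j \<and> j < length es \<and> (i, j) \<noteq> (0, length es - 1) \<longrightarrow>
              es ! i \<inter> es ! j = {})))"

definition three_uniform_hyperforest :: "'a marked_hypergraph \<Rightarrow> bool" where
  "three_uniform_hyperforest H \<longleftrightarrow>
     is_marked_hypergraph H \<and> three_uniform H \<and>
     \<not> (\<exists>C a. subhypergraph C H \<and> is_cycle a C)"

definition is_snake :: "'a \<Rightarrow> 'a marked_hypergraph \<Rightarrow> bool" where
  "is_snake x S \<longleftrightarrow> (\<exists>m\<in>marks S. is_path x m S)"

type_synonym 'a pointed_marked_hypergraph = "'a marked_hypergraph \<times> 'a"

definition pointed_iso ::
  "'a pointed_marked_hypergraph \<Rightarrow> 'a pointed_marked_hypergraph \<Rightarrow> bool" where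
  "pointed_iso = (\<lambda>(X, x) (Y, y).
     \<exists>f. bij_betw f (verts X) (verts Y) \<and> (`) f ` edges X = edges Y \<and>
         f ` marks X = marks Y \<and> f x = y)"

text \<open>
  A family of pointed marked hypergraphs is represented by its members whose vertices lie in the
  type of the host hypergraph. For a family closed under isomorphism, such as \<open>snakes\<close>, this
  determines the same copies as ranging over all vertex types.
\<close>

definition snakes :: "'a pointed_marked_hypergraph set" where
  "snakes = {(S, x). x \<in> nonmarked S \<and> is_snake x S \<and> card (marks S) = 1}"

definition copies_at ::
  "'a pointed_marked_hypergraph set \<Rightarrow> 'a \<Rightarrow> 'a marked_hypergraph \<Rightarrow> 'a marked_hypergraph set" where
  "copies_at F x H =
     {X. subhypergraph X H \<and> x \<in> verts X \<and> (\<exists>p\<in>F. pointed_iso (X, x) p)}"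

text \<open>For the empty collection this is the set of all non-marked vertices.\<close>

definition common_nonmarked ::
  "'a marked_hypergraph \<Rightarrow> 'a marked_hypergraph set \<Rightarrow> 'a set" where
  "common_nonmarked H \<X> = {v \<in> nonmarked H. \<forall>X\<in>\<X>. v \<in> verts X}"

definition J1 :: "'a pointed_marked_hypergraph set \<Rightarrow> 'a marked_hypergraph \<Rightarrow> bool" where
  "J1 F H \<longleftrightarrow>
     (\<forall>x\<in>nonmarked H. common_nonmarked (mark_vertex H x) (copies_at F x H) \<noteq> {})"

end

theory Submission
  imports Defs
begin

text \<open>
  Both sides are equivalent to the statement that no two distinct marked vertices lie in the same
  connected component. If two marked vertices are joined by a linear path, Maker wins by playing
  the successive joints of the path, each move forcing Breaker's answer; moreover the first joint of
  a shortest such path is the apex of two snakes that share no other vertex, so that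
  \<open>J\<^sub>1\<close> fails. Conversely, suppose that marked vertices are pairwise separated. In a hyperforest
  every edge is a bridge, so when Maker marks \<open>x\<close> in the component of the marked vertex \<open>m\<close>, some
  vertex \<open>y\<close> lies on all connections between \<open>x\<close> and \<open>m\<close>. This \<open>y\<close> witnesses \<open>J\<^sub>1\<close> at \<open>x\<close>, and
  deleting it restores separation.
\<close>

section \<open>Connectivity and linear paths\<close>

text \<open>A relation on the bare edge set, so that deleting an edge or all edges through a vertex
  only shrinks \<open>E\<close>. Every vertex is connected to itself, even one that lies in no
  edge.\<close>

definition conn :: "'a set set \<Rightarrow> 'a \<Rightarrow> 'a \<Rightarrow> bool" where
  "conn E a b \<longleftrightarrow> (a, b) \<in> {(u, v). \<exists>e\<in>E. u \<in> e \<and> v \<in> e}\<^sup>*"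

definition linear :: "'a set set \<Rightarrow> bool" where
  "linear E \<longleftrightarrow>
     (\<forall>e\<in>E. \<forall>f\<in>E. \<forall>u v. e \<noteq> f \<and> u \<in> e \<and> v \<in> e \<and> u \<in> f \<and> v \<in> f \<longrightarrow> u = v)"

text \<open>This is Berge-acyclicity, phrased so that any detour around an edge contradicts it
  directly.\<close>

definition bridged :: "'a set set \<Rightarrow> bool" where
  "bridged E \<longleftrightarrow> (\<forall>e\<in>E. \<forall>u\<in>e. \<forall>v\<in>e. conn (E - {e}) u v \<longrightarrow> u = v)"

text \<open>The equation for \<open>e\<close> carries the geometry of the path: with
  \<open>a \<noteq> c\<close> it keeps \<open>a\<close> off the later edges, and since
  \<open>c\<close> lies only in the first edge of the tail, it makes non-consecutive edges
  disjoint.\<close>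

inductive linear_path :: "'a \<Rightarrow> 'a \<Rightarrow> 'a set list \<Rightarrow> bool" where
  single: "a \<in> e \<Longrightarrow> b \<in> e \<Longrightarrow> a \<noteq> b \<Longrightarrow> linear_path a b [e]"
| cons: "linear_path c b es \<Longrightarrow> a \<in> e \<Longrightarrow> a \<noteq> c \<Longrightarrow> e \<inter> \<Union> (set es) = {c} \<Longrightarrow>
    linear_path a b (e # es)"

lemma conn_refl: "conn E a a"
  by (simp add: conn_def)

lemma conn_trans: "conn E a b \<Longrightarrow> conn E b c \<Longrightarrow> conn E a c"
  unfolding conn_def by (rule rtrancl_trans)

lemma conn_sym:
  assumes "conn E a b"
  shows "conn E b a"
proof -
  have "sym {(u, v). \<exists>e\<in>E. u \<in> e \<and> v \<in> e}"
    by (auto simp: sym_def)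
  then show ?thesis
    using assms unfolding conn_def by (meson symD sym_rtrancl)
qed

lemma conn_edge: "e \<in> E \<Longrightarrow> a \<in> e \<Longrightarrow> b \<in> e \<Longrightarrow> conn E a b"
  unfolding conn_def by (rule r_into_rtrancl) auto

lemma conn_mono: "conn E a b \<Longrightarrow> E \<subseteq> F \<Longrightarrow> conn F a b"
  unfolding conn_def by (erule rtrancl_mono[THEN subsetD, rotated]) auto

lemma linear_subset: "linear E \<Longrightarrow> F \<subseteq> E \<Longrightarrow> linear F"
  unfolding linear_def by (meson subsetD)

lemma bridged_subset:
  assumes "bridged E" and "F \<subseteq> E"
  shows "bridged F"
  unfolding bridged_def
proof (intro ballI impI)
  fix e u v
  assume "e \<in> F" "u \<in> e" "v \<in> e" "conn (F - {e}) u v"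
  moreover from this have "conn (E - {e}) u v"
    using assms(2) by (blast intro: conn_mono)
  ultimately show "u = v"
    using assms unfolding bridged_def by blast
qed

text \<open>A second edge through \<open>u\<close> and \<open>v\<close> is already a detour around
  the first.\<close>

lemma bridged_imp_linear:
  assumes "bridged E"
  shows "linear E"
  unfolding linear_def
proof (intro ballI allI impI, elim conjE)
  fix e f u v
  assume "e \<in> E" "f \<in> E" "e \<noteq> f" "u \<in> e" "v \<in> e" "u \<in> f" "v \<in> f"
  moreover from this have "conn (E - {e}) u v"
    by (auto intro: conn_edge[of f])
  ultimately show "u = v"
    using assms unfolding bridged_def by blast
qed

section \<open>Suffixes, extensions and existence of linear paths\<close>

lemma linear_path_nonempty: "linear_path a b es \<Longrightarrow> es \<noteq> []"
  by (induction rule: linear_path.induct) auto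

lemma linear_path_ends:
  "linear_path a b es \<Longrightarrow> a \<in> \<Union> (set es) \<and> b \<in> \<Union> (set es) \<and> a \<noteq> b"
  by (induction rule: linear_path.induct) auto

lemma linear_path_conn:
  "linear_path a b es \<Longrightarrow> set es \<subseteq> E \<Longrightarrow> conn E a b"
proof (induction rule: linear_path.induct)
  case (single a e b)
  then show ?case by (auto intro: conn_edge)
next
  case (cons c b es a e)
  then have "conn E a c" by (auto intro: conn_edge[of e])
  then show ?case using cons by (auto intro: conn_trans)
qed

text \<open>Edges are dropped as long as \<open>w\<close> still occurs in the tail; then
  \<open>w\<close> is in the first remaining edge but not on the next joint, so it can replace the
  start. The length bound serves the later inductions on length.\<close>

lemma linear_path_suffix:
  "linear_path a b es \<Longrightarrow> w \<in> \<Union> (set es) \<Longrightarrow> w \<noteq> b \<Longrightarrow>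
    \<exists>es'. linear_path w b es' \<and> set es' \<subseteq> set es \<and> length es' \<le> length es"
proof (induction rule: linear_path.induct)
  case (single a e b)
  then show ?case by (intro exI[of _ "[e]"]) (auto intro: linear_path.single)
next
  case (cons c b es a e)
  show ?case
  proof (cases "w \<in> \<Union> (set es)")
    case True
    then show ?thesis
      using cons.IH cons.prems(2) by (metis le_SucI length_Cons set_subset_Cons subset_trans)
  next
    case False
    have "linear_path w b (e # es)"
      by (rule linear_path.cons[of c]) (use cons.hyps cons.prems False linear_path_ends[OF cons.hyps(1)] in auto)
    then show ?thesis by auto
  qed
qed

lemma linear_inter:
  "linear E \<Longrightarrow> e \<in> E \<Longrightarrow> f \<in> E \<Longrightarrow> e \<noteq> f \<Longrightarrow> c \<in> e \<Longrightarrow> c \<in> f \<Longrightarrow> e \<inter> f = {c}"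
  unfolding linear_def by blast

text \<open>The path is cut at the last edge \<open>f\<close> that meets \<open>e\<close>. By
  linearity they meet in one vertex, so \<open>e\<close> can be put in front of \<open>f\<close>. If
  \<open>a\<close> is already in \<open>f\<close>, or \<open>e\<close> contains the endpoint
  \<open>b\<close>, then \<open>e\<close> or the cut path alone is enough.\<close>

lemma linear_path_extend:
  assumes "linear_path a' b es" "linear E" "set es \<subseteq> E" "e \<inter> \<Union> (set es) \<noteq> {}"
    and "e \<in> E" "a \<in> e" "a \<noteq> b"
  shows "\<exists>es'. linear_path a b es' \<and> set es' \<subseteq> E"
  using assms
proof (induction rule: linear_path.induct)
  case (single a' f b)
  consider "b \<in> e" | "a \<in> f" | "b \<notin> e" "a \<notin> f" by blast
  then show ?case
  proof cases
    case 1
    then show ?thesis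
      using single by (intro exI[of _ "[e]"]) (auto intro: linear_path.single)
  next
    case 2
    then show ?thesis
      using single by (intro exI[of _ "[f]"]) (auto intro: linear_path.single)
  next
    case 3
    from single obtain c where c: "c \<in> e" "c \<in> f" by auto
    have i: "e \<inter> f = {c}"
      using single.prems 3 c by (intro linear_inter[of E]) auto
    have p: "linear_path c b [f]"
      using single 3 c by (intro linear_path.single) auto
    have "linear_path a b [e, f]"
      by (rule linear_path.cons[OF p]) (use single.prems 3 c i in auto)
    then show ?thesis using single.prems by (intro exI[of _ "[e, f]"]) auto
  qed
next
  case (cons c' b es a' f)
  show ?case
  proof (cases "e \<inter> \<Union> (set es) = {}")
    case False
    then show ?thesis using cons.IH cons.prems by auto
  next
    case True
    then have c': "c' \<notin> e" using cons.hyps by auto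
    show ?thesis
    proof (cases "a \<in> f")
      case True
      have "linear_path a b (f # es)"
        by (rule linear_path.cons[of c']) (use cons.hyps cons.prems c' True in auto)
      then show ?thesis using cons.prems by blast
    next
      case False
      from True cons.prems obtain c where c: "c \<in> e" "c \<in> f" by auto
      have i: "e \<inter> f = {c}"
        using cons.prems False c by (intro linear_inter[of E]) auto
      have p: "linear_path c b (f # es)"
        by (rule linear_path.cons[of c']) (use cons.hyps c c' in auto)
      have "linear_path a b (e # f # es)"
        by (rule linear_path.cons[OF p]) (use cons.prems True False c i in auto)
      then show ?thesis using cons.prems by (intro exI[of _ "e # f # es"]) auto
    qed
  qed
qed

text \<open>The walk is processed backwards from \<open>b\<close>; \<open>linear_path_extend\<close>
  absorbs each new edge and takes shortcuts where the walk meets itself.\<close>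

lemma conn_imp_linear_path:
  assumes "conn E a b" "linear E" "a \<noteq> b"
  shows "\<exists>es. linear_path a b es \<and> set es \<subseteq> E"
  using assms(1)[unfolded conn_def] assms(3)
proof (induction rule: converse_rtrancl_induct)
  case base
  then show ?case by simp
next
  case (step a a')
  then obtain e where e: "e \<in> E" "a \<in> e" "a' \<in> e" by auto
  show ?case
  proof (cases "a' = b")
    case True
    then show ?thesis
      using e step.prems by (intro exI[of _ "[e]"]) (auto intro: linear_path.single)
  next
    case False
    then obtain es where es: "linear_path a' b es" "set es \<subseteq> E" using step by auto
    then have "e \<inter> \<Union> (set es) \<noteq> {}" using e linear_path_ends[OF es(1)] by auto
    then show ?thesis
      using linear_path_extend[OF es(1) assms(2) es(2) _ e(1,2) step.prems] by blast
  qed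
qed

text \<open>Translates the inductive form into the indexed conditions of \<open>is_path\<close>; the
  cycle built below uses them too.\<close>

lemma linear_path_nth:
  "linear_path a b es \<Longrightarrow>
    (\<forall>i. i + 1 < length es \<longrightarrow> card (es ! i \<inter> es ! (i + 1)) = 1) \<and>
    (\<forall>i j. i + 2 \<le> j \<and> j < length es \<longrightarrow> es ! i \<inter> es ! j = {}) \<and>
    a \<in> es ! 0 \<and> (\<forall>i. 0 < i \<and> i < length es \<longrightarrow> a \<notin> es ! i) \<and>
    b \<in> es ! (length es - 1) \<and> (\<forall>i. i < length es - 1 \<longrightarrow> b \<notin> es ! i)"
proof (induction rule: linear_path.induct)
  case (single a e b)
  then show ?case by auto
next
  case (cons c b es a e)
  note IH = cons.IH
  have ne: "es \<noteq> []" using cons.hyps(1) by (rule linear_path_nonempty)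
  have bc: "b \<noteq> c" "b \<in> \<Union> (set es)" using linear_path_ends[OF cons.hyps(1)] by auto
  have be: "b \<notin> e" using bc cons.hyps by blast
  have sub: "e \<inter> es ! i \<subseteq> {c}" if "i < length es" for i
    using cons.hyps(4) that nth_mem by blast
  have e0: "e \<inter> es ! 0 = {c}"
    using sub[of 0] ne IH cons.hyps(4) by auto
  have ei: "e \<inter> es ! i = {}" if "0 < i" "i < length es" for i
    using sub[of i] that IH by auto
  have "card ((e # es) ! i \<inter> (e # es) ! (i + 1)) = 1" if "i + 1 < length (e # es)" for i
    using that IH e0 by (cases i) auto
  moreover have "(e # es) ! i \<inter> (e # es) ! j = {}" if "i + 2 \<le> j" "j < length (e # es)" for i j
    using that IH ei[of "j - 1"] by (cases i; cases j) auto
  moreover have "a \<notin> (e # es) ! i" if "0 < i" "i < length (e # es)" for i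
    using that sub[of "i - 1"] cons.hyps by (cases i) auto
  moreover have "b \<in> (e # es) ! (length (e # es) - 1)"
    using IH ne by (cases es) auto
  moreover have "b \<notin> (e # es) ! i" if "i < length (e # es) - 1" for i
    using that IH be by (cases i) auto
  ultimately show ?case using cons.hyps(2) by auto
qed

section \<open>Every edge of a hyperforest is a bridge\<close>

text \<open>The vertices are those required of paths and cycles, the marks those required of a
  subhypergraph.\<close>

definition span :: "'a marked_hypergraph \<Rightarrow> 'a set list \<Rightarrow> 'a marked_hypergraph" where
  "span H es = \<lparr>verts = \<Union> (set es), edges = set es, marks = \<Union> (set es) \<inter> marks H\<rparr>"

lemma span_simps [simp]:
  "verts (span H es) = \<Union> (set es)" "edges (span H es) = set es"
  "marks (span H es) = \<Union> (set es) \<inter> marks H"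
  by (simp_all add: span_def)

lemma span_subhypergraph:
  assumes "is_marked_hypergraph H" "set es \<subseteq> edges H" "es \<noteq> []"
  shows "is_marked_hypergraph (span H es)" "subhypergraph (span H es) H"
proof -
  have sub: "\<Union> (set es) \<subseteq> verts H"
    using assms unfolding is_marked_hypergraph_def by blast
  have "\<Union> (set es) \<noteq> {}"
    using assms unfolding is_marked_hypergraph_def by (cases es) auto
  moreover have "finite (\<Union> (set es))"
    using sub assms(1) finite_subset unfolding is_marked_hypergraph_def by blast
  ultimately show "is_marked_hypergraph (span H es)"
    using assms unfolding is_marked_hypergraph_def by (auto simp: Union_upper)
  then show "subhypergraph (span H es) H"
    using sub assms unfolding subhypergraph_def by auto
qed

text \<open>Distinct edges of size 3 sharing two vertices meet in exactly two, which is a cycle of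
  length 2.\<close>

lemma hyperforest_linear:
  assumes "three_uniform_hyperforest H"
  shows "linear (edges H)"
  unfolding linear_def
proof (intro ballI allI impI, elim conjE, rule ccontr)
  fix e f u v
  assume ef: "e \<in> edges H" "f \<in> edges H" "e \<noteq> f"
    and uv: "u \<in> e" "v \<in> e" "u \<in> f" "v \<in> f" "u \<noteq> v"
  have H: "is_marked_hypergraph H" and c3: "card e = 3" "card f = 3"
    using assms ef unfolding three_uniform_hyperforest_def three_uniform_def by auto
  then have fin: "finite e" "finite f" by (auto intro: card_ge_0_finite)
  have "card (e \<inter> f) \<noteq> 3"
    using c3 fin ef(3) by (metis card_subset_eq inf.cobounded1 inf.cobounded2)
  moreover have "card (e \<inter> f) \<le> 3" using c3 fin by (metis card_mono inf.cobounded1)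
  moreover have "card {u, v} \<le> card (e \<inter> f)" using uv fin by (intro card_mono) auto
  ultimately have "card (e \<inter> f) = 2" using uv(5) by auto
  moreover have "is_marked_hypergraph (span H [e, f])" "subhypergraph (span H [e, f]) H"
    using span_subhypergraph[OF H, of "[e, f]"] ef by auto
  ultimately have "is_cycle u (span H [e, f])"
    unfolding is_cycle_def using c3 uv by (auto intro!: exI[of _ "[e, f]"])
  then show False
    using assms \<open>subhypergraph (span H [e, f]) H\<close> unfolding three_uniform_hyperforest_def by blast
qed

text \<open>A shortest linear path outside \<open>e\<close> between two vertices of \<open>e\<close>
  meets \<open>e\<close> only at its ends, so adding \<open>e\<close> closes it to a cycle. The
  induction varies \<open>u\<close> and keeps \<open>v\<close> fixed.\<close>

lemma hyperforest_no_detour: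
  assumes F: "three_uniform_hyperforest H" and e: "e \<in> edges H"
  shows "linear_path u v es \<Longrightarrow> set es \<subseteq> edges H - {e} \<Longrightarrow> u \<in> e \<Longrightarrow> v \<in> e \<Longrightarrow> False"
proof (induction "length es" arbitrary: u es rule: less_induct)
  case less
  have lin: "linear (edges H)" using F by (rule hyperforest_linear)
  have H: "is_marked_hypergraph H" and c3: "\<And>e. e \<in> edges H \<Longrightarrow> card e = 3"
    using F unfolding three_uniform_hyperforest_def three_uniform_def by auto
  have uv: "u \<noteq> v" using linear_path_ends[OF less.prems(1)] by blast
  from less.prems(1) show False
  proof cases
    case (single f)
    then have "f \<in> edges H" "e \<noteq> f" using less.prems(2) by auto
    then have "e \<inter> f = {u}"
      using linear_inter[OF lin e] less.prems(3) single(2) by metis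
    moreover have "v \<in> e \<inter> f" using less.prems(4) single(3) by simp
    ultimately show False using uv by simp
  next
    case (cons c rest f)
    have ne: "rest \<noteq> []" using cons(2) by (rule linear_path_nonempty)
    have ef: "e \<inter> f = {u}"
      using less.prems e cons by (intro linear_inter[OF lin]) auto
    \<comment> \<open>Any other vertex of \<open>e\<close> on the tail would start a shorter detour
      to \<open>v\<close>.\<close>
    have erest: "w = v" if "w \<in> e" "w \<in> \<Union> (set rest)" for w
    proof (rule ccontr)
      assume "w \<noteq> v"
      from linear_path_suffix[OF cons(2) that(2) this] obtain es'
        where es': "linear_path w v es'" "set es' \<subseteq> set rest" "length es' \<le> length rest" by blast
      show False
        by (rule less.hyps[OF _ es'(1) _ that(1) less.prems(4)]) (use es' cons less.prems in auto)
    qed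
    have sub: "e \<inter> g \<subseteq> {u, v}" if "g \<in> set es" for g
      using that cons ef erest by auto
    note P = linear_path_nth[OF less.prems(1)]
    let ?n = "length es"
    have n: "?n \<ge> 2" using cons ne by (cases rest) auto
    have e0: "e \<inter> es ! 0 = {u}" using ef cons by simp
    have nth: "es ! i \<in> set es" if "i < ?n" for i using that by simp
    have eN: "e \<inter> es ! (?n - 1) = {v}"
    proof -
      have "?n - 1 < ?n" "0 < ?n - 1" using n by auto
      then have "e \<inter> es ! (?n - 1) \<subseteq> {u, v}" "u \<notin> es ! (?n - 1)" "v \<in> es ! (?n - 1)"
        using sub[OF nth] P by blast+
      then show ?thesis using less.prems(4) by blast
    qed
    have ei: "e \<inter> es ! i = {}" if "0 < i" "i < ?n - 1" for i
    proof -
      have "e \<inter> es ! i \<subseteq> {u, v}" using sub[OF nth, of i] that by linarith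
      moreover have "u \<notin> es ! i" "v \<notin> es ! i" using P that by auto
      ultimately show ?thesis by blast
    qed
    \<comment> \<open>With \<open>e\<close> in front, \<open>u\<close> joins the first two edges and
      \<open>v\<close> lies in the first and the last one, so \<open>v\<close> is the base point.
      Path indices shift by one; the length is at least 3.\<close>
    let ?C = "e # es"
    have len: "length ?C - 1 = ?n" "?C ! ?n = es ! (?n - 1)"
      using n by (auto simp: nth_Cons')
    have 1: "card (?C ! i \<inter> ?C ! (i + 1)) = 1" if "i + 1 < length ?C" for i
      using that P e0 by (cases i) auto
    have 2: "?C ! i \<inter> ?C ! j = {}" if "i + 2 \<le> j" "j < length ?C" "(i, j) \<noteq> (0, length ?C - 1)" for i j
      using that P ei[of "j - 1"] by (cases i; cases j) auto
    have 3: "v \<notin> ?C ! i" if "0 < i" "i < length ?C - 1" for i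
      using that P by (cases i) auto
    have S: "is_marked_hypergraph (span H ?C)" "subhypergraph (span H ?C) H"
      using span_subhypergraph[OF H, of ?C] e less.prems by auto
    have "is_cycle v (span H ?C)"
      unfolding is_cycle_def
    proof (intro conjI exI[of _ ?C] impI allI)
      show "v \<in> ?C ! 0 \<inter> ?C ! (length ?C - 1)"
        using eN unfolding len by auto
      show "?C ! 0 \<inter> ?C ! (length ?C - 1) = {v}"
        using eN unfolding len by auto
    qed (use S 1 2 3 n c3 e less.prems in auto)
    then show False using S(2) F unfolding three_uniform_hyperforest_def by blast
  qed
qed

lemma hyperforest_bridged:
  assumes "three_uniform_hyperforest H"
  shows "bridged (edges H)"
  unfolding bridged_def
proof (intro ballI impI, rule ccontr)
  fix e u v
  assume e: "e \<in> edges H" "u \<in> e" "v \<in> e" "conn (edges H - {e}) u v" "u \<noteq> v"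
  have "linear (edges H - {e})"
    using hyperforest_linear[OF assms] by (rule linear_subset) auto
  from conn_imp_linear_path[OF e(4) this e(5)] show False
    using hyperforest_no_detour[OF assms e(1) _ _ e(2,3)] by blast
qed

section \<open>Separating two connected vertices by deleting a third\<close>

text \<open>Take the first edge \<open>e\<close> of a linear path from \<open>x\<close> to
  \<open>m\<close>. Its third vertex, besides \<open>x\<close> and the vertex where the path leaves
  \<open>e\<close>, serves as \<open>y\<close>: deleting \<open>y\<close> destroys \<open>e\<close>,
  which is a bridge between \<open>x\<close> and that exit.\<close>

lemma bridged_separating_vertex:
  assumes B: "bridged E" and c3: "\<forall>e\<in>E. card e = 3" and xm: "conn E x m" "x \<noteq> m"
  shows "\<exists>y\<in>\<Union> E. y \<noteq> x \<and> y \<noteq> m \<and> conn E x y \<and> \<not> conn {e \<in> E. y \<notin> e} x m"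
proof -
  obtain es where es: "linear_path x m es" "set es \<subseteq> E"
    using conn_imp_linear_path[OF xm(1) bridged_imp_linear[OF B] xm(2)] by blast
  have third: "\<exists>y\<in>e. y \<noteq> x \<and> y \<noteq> c" if "e \<in> E" for e c
  proof (rule ccontr)
    assume "\<not> ?thesis"
    then have "e \<subseteq> {x, c}" by blast
    then have "card e \<le> card {x, c}" by (intro card_mono) auto
    also have "\<dots> \<le> 2" by (simp add: card_insert_if)
    finally show False using c3 that by auto
  qed
  from es(1) show ?thesis
  proof cases
    case (single e)
    then have eE: "e \<in> E" using es by auto
    from third[OF this] obtain y where y: "y \<in> e" "y \<noteq> x" "y \<noteq> m" by blast
    have "\<not> conn {e \<in> E. y \<notin> e} x m"
    proof
      assume "conn {e \<in> E. y \<notin> e} x m"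
      then have "conn (E - {e}) x m" by (rule conn_mono) (use y in auto)
      then show False using B eE single xm(2) unfolding bridged_def by blast
    qed
    then show ?thesis using y eE single conn_edge[OF eE, of x y] by blast
  next
    case (cons c rest e)
    then have eE: "e \<in> E" using es by auto
    from third[OF this] obtain y where y: "y \<in> e" "y \<noteq> x" "y \<noteq> c" by blast
    have ce: "c \<in> e" using cons by blast
    have m: "m \<noteq> c" "m \<in> \<Union> (set rest)" using linear_path_ends[OF cons(2)] by auto
    then have ym: "y \<noteq> m" using cons y by blast
    have "e \<notin> set rest" using cons by blast
    then have "set rest \<subseteq> E - {e}" using es cons by auto
    \<comment> \<open>The tail still joins \<open>c\<close> to \<open>m\<close> without
      \<open>e\<close>, so a surviving connection from \<open>x\<close> to \<open>m\<close> would
      link \<open>x\<close> to \<open>c\<close> around \<open>e\<close>.\<close>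
    then have cm: "conn (E - {e}) c m" using linear_path_conn[OF cons(2)] by blast
    have "\<not> conn {e \<in> E. y \<notin> e} x m"
    proof
      assume "conn {e \<in> E. y \<notin> e} x m"
      then have "conn (E - {e}) x m" by (rule conn_mono) (use y in auto)
      then have "conn (E - {e}) x c" using cm conn_sym conn_trans by metis
      then show False using B eE cons ce unfolding bridged_def by blast
    qed
    then show ?thesis using y ym eE cons conn_edge[OF eE, of x y] by blast
  qed
qed

section \<open>The game\<close>

definition marks_separated :: "'a set set \<Rightarrow> 'a set \<Rightarrow> bool" where
  "marks_separated E M \<longleftrightarrow> (\<forall>a\<in>M. \<forall>b\<in>M. conn E a b \<longrightarrow> a = b)"

text \<open>With \<open>card_le_imp_two_marks\<close>, this turns a trivial Maker win into an edge
  of size 3 with two marks.\<close>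

lemma two_marks_imp_card_le:
  assumes "card e = 3" "a \<in> e" "b \<in> e" "a \<noteq> b" "a \<in> M" "b \<in> M"
  shows "card (e - M) \<le> 1"
proof -
  have "finite e" using assms by (auto intro: card_ge_0_finite)
  moreover have "e - M \<subseteq> e - {a, b}" using assms by auto
  ultimately have "card (e - M) \<le> card (e - {a, b})" by (intro card_mono) auto
  also have "\<dots> = 1" using assms \<open>finite e\<close> by (simp add: card_Diff_subset)
  finally show ?thesis .
qed

lemma card_le_imp_two_marks:
  assumes "card e = 3" "card (e - M) \<le> 1"
  shows "\<exists>a\<in>e \<inter> M. \<exists>b\<in>e \<inter> M. a \<noteq> b"
proof -
  have "finite e" using assms by (auto intro: card_ge_0_finite)
  have "card (e \<inter> M) + card (e - M) = 3"
    using assms(1) \<open>finite e\<close> by (metis card_Int_Diff)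
  then have "2 \<le> card (e \<inter> M)" using assms(2) by linarith
  then obtain T where T: "T \<subseteq> e \<inter> M" "card T = 2"
    using obtain_subset_with_card_n by metis
  then show ?thesis by (auto simp: card_2_iff)
qed

lemma position_simps [simp]:
  "verts (delete_vertex (mark_vertex H x) y) = verts H - {y}"
  "edges (delete_vertex (mark_vertex H x) y) = {e \<in> edges H. y \<notin> e}"
  "marks (delete_vertex (mark_vertex H x) y) = insert x (marks H) - {y}"
  by (simp_all add: delete_vertex_def mark_vertex_def)

section \<open>Maker's strategy\<close>

text \<open>\<open>maker_win\<close> tests triviality only in final positions, so the win must be
  carried there: Maker marks the last non-marked vertex of \<open>e\<close>, or any vertex if there
  is none, and no reply can then delete a vertex of \<open>e\<close>.\<close>

lemma trivial_maker_win_imp_maker_win: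
  "trivial_maker_win H \<Longrightarrow> finite (verts H) \<Longrightarrow> \<forall>e\<in>edges H. e \<subseteq> verts H \<Longrightarrow> maker_win H"
proof (induction H rule: maker_win.induct)
  case (1 H)
  show ?case
  proof (cases "card (nonmarked H) \<le> 1")
    case True
    then show ?thesis using 1(2) by (simp add: maker_win.simps)
  next
    case False
    from 1(2) obtain e where e: "e \<in> edges H" "card (e - marks H) \<le> 1"
      unfolding trivial_maker_win_def by blast
    have fin: "finite (e - marks H)"
      using e 1(3,4) finite_subset by blast
    have "\<exists>x\<in>nonmarked H. e - marks H \<subseteq> {x}"
    proof (cases "e - marks H = {}")
      case True
      moreover have "nonmarked H \<noteq> {}" using False by auto
      ultimately show ?thesis by blast
    next
      case False
      then have "card (e - marks H) = 1" using e fin by (simp add: le_Suc_eq)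
      then obtain x where "e - marks H = {x}" by (auto simp: card_1_singleton_iff)
      then show ?thesis using e 1(4) unfolding nonmarked_def by blast
    qed
    then obtain x where x: "x \<in> nonmarked H" "e - marks H \<subseteq> {x}" by blast
    have "maker_win (delete_vertex (mark_vertex H x) y)" if y: "y \<in> nonmarked H - {x}" for y
    proof (rule 1(1)[OF False x(1) y])
      have "y \<notin> e" using x y unfolding nonmarked_def by blast
      moreover from this have "e - (insert x (marks H) - {y}) = {}" using x by blast
      then have "card (e - (insert x (marks H) - {y})) \<le> 1" by (simp only: card.empty)
      ultimately show "trivial_maker_win (delete_vertex (mark_vertex H x) y)"
        unfolding trivial_maker_win_def using e by (intro bexI[of _ e]) simp_all
    qed (use 1(3,4) in auto)
    then show ?thesis using False x by (subst maker_win.simps) auto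
  qed
qed

text \<open>Maker marks the first joint \<open>c\<close>, so that \<open>e\<close> holds the marks
  \<open>a\<close> and \<open>c\<close>. A reply outside \<open>e\<close> leaves a trivial win; a
  reply in \<open>e\<close> spares the tail, a shorter path between the marks \<open>c\<close> and
  \<open>b\<close>.\<close>

lemma linear_path_imp_maker_win:
  "linear_path a b es \<Longrightarrow> set es \<subseteq> edges H \<Longrightarrow> a \<in> marks H \<Longrightarrow> b \<in> marks H \<Longrightarrow>
    finite (verts H) \<Longrightarrow> \<forall>e\<in>edges H. e \<subseteq> verts H \<Longrightarrow> \<forall>e\<in>edges H. card e = 3 \<Longrightarrow> maker_win H"
proof (induction arbitrary: H rule: linear_path.induct)
  case (single a e b)
  then have "trivial_maker_win H"
    unfolding trivial_maker_win_def by (intro bexI[of _ e] two_marks_imp_card_le[of e a b]) auto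
  then show ?case using single.prems trivial_maker_win_imp_maker_win by blast
next
  case (cons c b es a e)
  show ?case
  proof (cases "trivial_maker_win H")
    case True
    then show ?thesis using cons.prems trivial_maker_win_imp_maker_win by blast
  next
    case False
    have e: "e \<in> edges H" "card e = 3" "e \<subseteq> verts H" using cons.prems by auto
    have ce: "c \<in> e" using cons.hyps by blast
    \<comment> \<open>Without a trivial win, \<open>e\<close> has two non-marked vertices: the
      recursive clause of \<open>maker_win\<close> applies, and \<open>c\<close> is not yet
      marked.\<close>
    have big: "2 \<le> card (e - marks H)" using False e unfolding trivial_maker_win_def by fastforce
    have "e - marks H \<subseteq> nonmarked H" "finite (nonmarked H)"
      using e cons.prems unfolding nonmarked_def by auto
    then have n: "\<not> card (nonmarked H) \<le> 1"
      using big card_mono[of "nonmarked H" "e - marks H"] by linarith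
    have "c \<notin> marks H"
      using two_marks_imp_card_le[OF e(2) cons.hyps(2) ce cons.hyps(3)] cons.prems big by fastforce
    then have c: "c \<in> nonmarked H" using ce e unfolding nonmarked_def by blast
    have b: "b \<in> marks H" "b \<noteq> c" using cons.prems linear_path_ends[OF cons.hyps(1)] by auto
    have "maker_win (delete_vertex (mark_vertex H c) y)" if y: "y \<in> nonmarked H - {c}" for y
    proof (cases "y \<in> e")
      case True
      then have "set es \<subseteq> {e \<in> edges H. y \<notin> e}"
        using cons.prems cons.hyps y by auto
      moreover have "b \<noteq> y" using y b unfolding nonmarked_def by blast
      ultimately show ?thesis
        using cons.prems b y by (intro cons.IH) auto
    next
      case False
      have "a \<noteq> y" using y cons.prems unfolding nonmarked_def by blast
      then have "trivial_maker_win (delete_vertex (mark_vertex H c) y)"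
        unfolding trivial_maker_win_def using False e cons.hyps cons.prems ce y
        by (intro bexI[of _ e] two_marks_imp_card_le[of e a c]) auto
      then show ?thesis
        using cons.prems by (intro trivial_maker_win_imp_maker_win) auto
    qed
    then show ?thesis using n c by (subst maker_win.simps) auto
  qed
qed

section \<open>Breaker's strategy\<close>

text \<open>Separation is an invariant that Breaker can restore after each move of Maker, and in a
  final position it excludes an edge with two marks.\<close>

lemma marks_separated_imp_breaker_win:
  "bridged (edges H) \<Longrightarrow> \<forall>e\<in>edges H. card e = 3 \<and> e \<subseteq> verts H \<Longrightarrow>
    marks_separated (edges H) (marks H) \<Longrightarrow> \<not> maker_win H"
proof (induction H rule: maker_win.induct)
  case (1 H)
  note sep = 1(4)[unfolded marks_separated_def, rule_format]
  show ?case
  proof (cases "card (nonmarked H) \<le> 1")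
    case True
    have "\<not> trivial_maker_win H"
    proof
      assume "trivial_maker_win H"
      then obtain e where e: "e \<in> edges H" "card (e - marks H) \<le> 1"
        unfolding trivial_maker_win_def by blast
      with 1(3) card_le_imp_two_marks obtain a b where
        "a \<in> e \<inter> marks H" "b \<in> e \<inter> marks H" "a \<noteq> b" by blast
      then show False using sep conn_edge[OF e(1), of a b] by blast
    qed
    then show ?thesis using True by (simp add: maker_win.simps)
  next
    case False
    have "\<exists>y\<in>nonmarked H - {x}. \<not> maker_win (delete_vertex (mark_vertex H x) y)"
      if x: "x \<in> nonmarked H" for x
    proof -
      have reply: "\<exists>y\<in>nonmarked H - {x}. \<forall>m\<in>marks H. \<not> conn {e \<in> edges H. y \<notin> e} x m"
      proof (cases "\<exists>m\<in>marks H. conn (edges H) x m")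
        case True
        then obtain m where m: "m \<in> marks H" "conn (edges H) x m" by blast
        then have "x \<noteq> m" using x unfolding nonmarked_def by blast
        with bridged_separating_vertex[OF 1(2) _ m(2)] 1(3) obtain y where
          y: "y \<in> \<Union> (edges H)" "y \<noteq> x" "y \<noteq> m" "conn (edges H) x y"
            "\<not> conn {e \<in> edges H. y \<notin> e} x m" by blast
        \<comment> \<open>\<open>y\<close> is connected to \<open>m\<close> through
          \<open>x\<close>, so as a mark it would equal \<open>m\<close>.\<close>
        have "y \<notin> marks H"
          using sep[OF _ m(1)] y conn_trans[OF conn_sym[OF y(4)] m(2)] by blast
        then have "y \<in> nonmarked H - {x}" using y 1(3) unfolding nonmarked_def by blast
        moreover have "\<not> conn {e \<in> edges H. y \<notin> e} x m'" if "m' \<in> marks H" for m'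
        proof
          assume c: "conn {e \<in> edges H. y \<notin> e} x m'"
          then have "conn (edges H) x m'" by (rule conn_mono) auto
          then have "m' = m" using sep[OF that m(1)] conn_trans[OF conn_sym m(2)] by blast
          then show False using c y by blast
        qed
        ultimately show ?thesis by blast
      next
        case none: False
        have "\<not> nonmarked H \<subseteq> {x}"
          using False card_mono[of "{x}" "nonmarked H"] by auto
        then obtain y where "y \<in> nonmarked H - {x}" by blast
        moreover have "\<not> conn {e \<in> edges H. y \<notin> e} x m" if "m \<in> marks H" for m
          using none that conn_mono[of "{e \<in> edges H. y \<notin> e}" x m "edges H"] by blast
        ultimately show ?thesis by blast
      qed
      then obtain y where y: "y \<in> nonmarked H - {x}"
        and no: "\<And>m. m \<in> marks H \<Longrightarrow> \<not> conn {e \<in> edges H. y \<notin> e} x m" by blast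
      have "\<not> maker_win (delete_vertex (mark_vertex H x) y)"
      proof (rule 1(1)[OF False x y])
        show "bridged (edges (delete_vertex (mark_vertex H x) y))"
          using 1(2) by (auto intro: bridged_subset)
        show "\<forall>e\<in>edges (delete_vertex (mark_vertex H x) y).
            card e = 3 \<and> e \<subseteq> verts (delete_vertex (mark_vertex H x) y)"
          using 1(3) by auto
        \<comment> \<open>Two old marks stay separated because deletion only removes connections;
          \<open>x\<close> is cut off from every old mark by the choice of \<open>y\<close>.\<close>
        have "a = b" if "a \<in> insert x (marks H)" "b \<in> insert x (marks H)"
          and ab: "conn {e \<in> edges H. y \<notin> e} a b" for a b
        proof -
          have "conn (edges H) a b" using ab by (rule conn_mono) auto
          then show ?thesis
            using that sep[of a b] no[of b] no[of a] conn_sym[OF ab] by blast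
        qed
        then show "marks_separated (edges (delete_vertex (mark_vertex H x) y))
            (marks (delete_vertex (mark_vertex H x) y))"
          unfolding marks_separated_def by auto
      qed
      then show ?thesis using y by blast
    qed
    then show ?thesis using False by (subst maker_win.simps) auto
  qed
qed

section \<open>Snakes\<close>

text \<open>The span is itself a snake, so the identity is the isomorphism.\<close>

lemma linear_path_imp_snake_copy:
  assumes H: "is_marked_hypergraph H" and c3: "\<forall>e\<in>edges H. card e = 3"
    and es: "linear_path x m es" "set es \<subseteq> edges H"
    and x: "x \<notin> marks H" and m: "\<Union> (set es) \<inter> marks H = {m}"
  shows "span H es \<in> copies_at snakes x H"
proof -
  have ne: "es \<noteq> []" using es(1) by (rule linear_path_nonempty)
  note S = span_subhypergraph[OF H es(2) ne]
  have ends: "x \<in> \<Union> (set es)" "x \<noteq> m" using linear_path_ends[OF es(1)] by auto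
  have "is_path x m (span H es)"
    unfolding is_path_def
    by (intro conjI exI[of _ es])
      (use S ends ne c3 es(2) linear_path_nth[OF es(1)] in \<open>auto simp: Suc_le_eq\<close>)
  then have "is_snake x (span H es)"
    unfolding is_snake_def using m by auto
  then have "(span H es, x) \<in> snakes"
    unfolding snakes_def using ends x m by (auto simp: nonmarked_def)
  moreover have "pointed_iso (span H es, x) (span H es, x)"
    unfolding pointed_iso_def by (auto intro!: exI[of _ id])
  ultimately show ?thesis
    unfolding copies_at_def using S ends by auto
qed

text \<open>On a shortest path between marks, the first joint \<open>c\<close> starts two snakes,
  \<open>[e]\<close> back to \<open>a\<close> and the tail on to \<open>b\<close>, which share only
  \<open>c\<close>. Marking \<open>c\<close> leaves them no common non-marked vertex.\<close>

lemma J1_imp_no_linear_path: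
  assumes F: "three_uniform_hyperforest H" and nt: "\<not> trivial_maker_win H" and J: "J1 snakes H"
  shows "linear_path a b es \<Longrightarrow> set es \<subseteq> edges H \<Longrightarrow> a \<in> marks H \<Longrightarrow> b \<in> marks H \<Longrightarrow> False"
proof (induction "length es" arbitrary: a es rule: less_induct)
  case less
  have H: "is_marked_hypergraph H" and c3: "\<forall>e\<in>edges H. card e = 3"
    using F unfolding three_uniform_hyperforest_def three_uniform_def by auto
  have one: "u = v" if "e \<in> edges H" "u \<in> e" "v \<in> e" "u \<in> marks H" "v \<in> marks H" for e u v
    using that nt c3 two_marks_imp_card_le[of e u v "marks H"] unfolding trivial_maker_win_def by blast
  from less.prems(1) show False
  proof cases
    case (single e)
    then show False using one[of e a b] less.prems by auto
  next
    case (cons c rest e)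
    have e: "e \<in> edges H" "c \<in> e" and rest: "set rest \<subseteq> edges H" using cons less.prems by auto
    have c: "c \<notin> marks H" using one[of e a c] e cons less.prems by blast
    \<comment> \<open>Minimality: another mark on the tail would start a shorter path to
      \<open>b\<close>. Hence the tail has exactly one mark.\<close>
    have "w = b" if "w \<in> \<Union> (set rest)" "w \<in> marks H" for w
    proof (rule ccontr)
      assume "w \<noteq> b"
      from linear_path_suffix[OF cons(2) that(1) this] obtain es'
        where es': "linear_path w b es'" "set es' \<subseteq> set rest" "length es' \<le> length rest" by blast
      show False
        by (rule less.hyps[OF _ es'(1) _ that(2) less.prems(4)]) (use es' cons rest in auto)
    qed
    then have mr: "\<Union> (set rest) \<inter> marks H = {b}"
      using linear_path_ends[OF cons(2)] less.prems by blast
    have me: "\<Union> (set [e]) \<inter> marks H = {a}"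
      using one[OF e(1)] cons less.prems by auto
    have "linear_path c a [e]" using cons e by (intro linear_path.single) auto
    then have 1: "span H [e] \<in> copies_at snakes c H"
      using e me c by (intro linear_path_imp_snake_copy[OF H c3]) auto
    have 2: "span H rest \<in> copies_at snakes c H"
      using cons rest mr c by (intro linear_path_imp_snake_copy[OF H c3]) auto
    have "c \<in> nonmarked H"
      using c e H unfolding nonmarked_def is_marked_hypergraph_def by blast
    then obtain v where v: "v \<in> common_nonmarked (mark_vertex H c) (copies_at snakes c H)"
      using J unfolding J1_def by blast
    then have "v \<noteq> c" unfolding common_nonmarked_def nonmarked_def mark_vertex_def by auto
    moreover have "v \<in> verts (span H [e])" "v \<in> verts (span H rest)"
      using v 1 2 unfolding common_nonmarked_def by blast+
    ultimately show False using cons(5) by auto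
  qed
qed

section \<open>From separated marks to \<open>J1\<close>\<close>

lemma nth_chain_conn:
  assumes "\<forall>i. i + 1 < length es \<longrightarrow> es ! i \<inter> es ! (i + 1) \<noteq> {}"
    and "a \<in> es ! 0"
  shows "k < length es \<Longrightarrow> v \<in> es ! k \<Longrightarrow> conn (set es) a v"
proof (induction k arbitrary: v)
  case 0
  then show ?case using assms(2) by (intro conn_edge[of "es ! 0"]) auto
next
  case (Suc k)
  then obtain w where w: "w \<in> es ! k" "w \<in> es ! Suc k" using assms(1) by fastforce
  then have "conn (set es) a w" using Suc by simp
  moreover have "conn (set es) w v"
    using Suc.prems w by (intro conn_edge[of "es ! Suc k"]) auto
  ultimately show ?case by (rule conn_trans)
qed

lemma is_path_conn:
  assumes "is_path a b P"
  shows "conn (edges P) a b"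
proof -
  from assms obtain es where es: "length es \<ge> 1" "edges P = set es"
    "\<forall>i. i + 1 < length es \<longrightarrow> card (es ! i \<inter> es ! (i + 1)) = 1"
    "a \<in> es ! 0" "b \<in> es ! (length es - 1)"
    unfolding is_path_def by blast
  have "\<forall>i. i + 1 < length es \<longrightarrow> es ! i \<inter> es ! (i + 1) \<noteq> {}"
    using es(3) by fastforce
  then show ?thesis
    using nth_chain_conn[of es a "length es - 1" b] es by auto
qed

lemma conn_image:
  assumes "conn E a b"
  shows "conn ((`) g ` E) (g a) (g b)"
  using assms[unfolded conn_def]
proof (induction rule: rtrancl_induct)
  case base
  then show ?case by (rule conn_refl)
next
  case (step b c)
  then have "conn ((`) g ` E) (g b) (g c)" by (auto intro: conn_edge)
  then show ?case using step.IH by (blast intro: conn_trans)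
qed

text \<open>A copy comes only with a bijection onto a snake, so the connection along the snake is
  pulled back through the inverse.\<close>

lemma snake_copy_conn:
  fixes X :: "'a marked_hypergraph"
  assumes "X \<in> copies_at snakes x H"
  shows "\<exists>m\<in>marks X. conn (edges X) x m"
proof -
  from assms obtain S :: "'a marked_hypergraph" and s f m where
    X: "is_marked_hypergraph X" "x \<in> verts X" and
    f: "bij_betw f (verts X) (verts S)" "(`) f ` edges X = edges S" "f ` marks X = marks S" "f x = s"
    and m: "m \<in> marks S" "is_path s m S"
    unfolding copies_at_def snakes_def pointed_iso_def is_snake_def subhypergraph_def
    by (auto simp del: ex_simps)
  let ?g = "inv_into (verts X) f"
  have inj: "inj_on f (verts X)" using f by (auto simp: bij_betw_def)
  have "?g ` f ` e = e" if "e \<in> edges X" for e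
    using inv_into_image_cancel[OF inj, of e] that X(1) unfolding is_marked_hypergraph_def by blast
  then have "(`) ?g ` edges S = edges X"
    unfolding f(2)[symmetric] by (force simp: image_iff)
  moreover have "conn ((`) ?g ` edges S) (?g s) (?g m)"
    using is_path_conn[OF m(2)] by (rule conn_image)
  moreover have "?g s = x" using inj X f by auto
  moreover from m(1)[folded f(3)] obtain m' where m': "m' \<in> marks X" "f m' = m" by (rule imageE) simp
  moreover have "?g m = m'"
    using m' inj X unfolding is_marked_hypergraph_def by auto
  ultimately show ?thesis by auto
qed

text \<open>Breaker's reply to \<open>x\<close> is the common vertex. If \<open>x\<close> is
  connected to a mark \<open>m\<close>, every copy joins \<open>x\<close> to that mark and so must
  contain the separating vertex. Otherwise there are no copies, and any other non-marked vertex will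
  do.\<close>

lemma marks_separated_imp_J1:
  assumes B: "bridged (edges H)" and H: "is_marked_hypergraph H" and c3: "\<forall>e\<in>edges H. card e = 3"
    and sep: "marks_separated (edges H) (marks H)" and two: "card (nonmarked H) \<ge> 2"
  shows "J1 snakes H"
  unfolding J1_def
proof
  fix x
  assume x: "x \<in> nonmarked H"
  \<comment> \<open>The connection in \<open>H\<close> identifies the mark; the one inside
    \<open>X\<close> is needed to see that it avoids \<open>y\<close> when \<open>X\<close>
    does.\<close>
  have copy: "\<exists>m\<in>marks H. conn (edges X) x m \<and> conn (edges H) x m"
    if X: "X \<in> copies_at snakes x H" for X
  proof -
    obtain m where m: "m \<in> marks X" "conn (edges X) x m" using snake_copy_conn[OF X] by blast
    moreover have "edges X \<subseteq> edges H" "marks X \<subseteq> marks H"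
      using X unfolding copies_at_def subhypergraph_def by auto
    ultimately show ?thesis using conn_mono[of "edges X" x m "edges H"] by blast
  qed
  have nm: "nonmarked (mark_vertex H x) = nonmarked H - {x}"
    unfolding nonmarked_def mark_vertex_def by auto
  show "common_nonmarked (mark_vertex H x) (copies_at snakes x H) \<noteq> {}"
  proof (cases "\<exists>m\<in>marks H. conn (edges H) x m")
    case True
    then obtain m where m: "m \<in> marks H" "conn (edges H) x m" by blast
    then have "x \<noteq> m" using x unfolding nonmarked_def by blast
    with bridged_separating_vertex[OF B c3 m(2)] obtain y where
      y: "y \<in> \<Union> (edges H)" "y \<noteq> x" "y \<noteq> m" "conn (edges H) x y"
        "\<not> conn {e \<in> edges H. y \<notin> e} x m" by blast
    have "y \<notin> marks H"
      using sep m(1) y(3) conn_trans[OF conn_sym[OF y(4)] m(2)]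
      unfolding marks_separated_def by blast
    then have "y \<in> nonmarked H - {x}"
      using y H unfolding nonmarked_def is_marked_hypergraph_def by blast
    moreover have "y \<in> verts X" if X: "X \<in> copies_at snakes x H" for X
    proof (rule ccontr)
      assume "y \<notin> verts X"
      then have sub: "edges X \<subseteq> {e \<in> edges H. y \<notin> e}"
        using X unfolding copies_at_def subhypergraph_def is_marked_hypergraph_def by blast
      obtain m' where m': "m' \<in> marks H" "conn (edges X) x m'" "conn (edges H) x m'"
        using copy[OF X] by blast
      have "m' = m"
        using sep m' m(1) conn_trans[OF conn_sym[OF m'(3)] m(2)] unfolding marks_separated_def by blast
      then show False using y(5) conn_mono[OF m'(2) sub] by blast
    qed
    ultimately show ?thesis unfolding common_nonmarked_def nm by blast
  next
    case False
    then have "copies_at snakes x H = {}" using copy by blast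
    moreover have "\<not> nonmarked H \<subseteq> {x}"
      using two card_mono[of "{x}" "nonmarked H"] by auto
    ultimately show ?thesis unfolding common_nonmarked_def nm by auto
  qed
qed

theorem mainTheorem8:
  fixes H :: "'a marked_hypergraph"
  assumes "three_uniform_hyperforest H"
    and "\<not> trivial_maker_win H"
    and "card (nonmarked H) \<ge> 2"
  shows "breaker_win H \<longleftrightarrow> J1 snakes H"
proof -
  have H: "is_marked_hypergraph H" and c3: "\<forall>e\<in>edges H. card e = 3"
    using assms unfolding three_uniform_hyperforest_def three_uniform_def by auto
  then have fin: "finite (verts H)" and sub: "\<forall>e\<in>edges H. e \<subseteq> verts H"
    unfolding is_marked_hypergraph_def by auto
  have B: "bridged (edges H)" using assms(1) by (rule hyperforest_bridged)
  \<comment> \<open>Both directions refute this path, by Maker's strategy and by \<open>J1\<close>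
    respectively, to obtain separated marks.\<close>
  have path: "\<exists>a\<in>marks H. \<exists>b\<in>marks H. \<exists>es. linear_path a b es \<and> set es \<subseteq> edges H"
    if "\<not> marks_separated (edges H) (marks H)"
    using that conn_imp_linear_path[OF _ bridged_imp_linear[OF B]]
    unfolding marks_separated_def by blast
  show ?thesis
  proof
    assume "breaker_win H"
    then have "marks_separated (edges H) (marks H)"
      using path linear_path_imp_maker_win[OF _ _ _ _ fin sub c3] unfolding breaker_win_def by blast
    then show "J1 snakes H" using marks_separated_imp_J1[OF B H c3] assms(3) by blast
  next
    assume "J1 snakes H"
    then have "marks_separated (edges H) (marks H)"
      using path J1_imp_no_linear_path[OF assms(1,2)] by blast
    then show "breaker_win H"
      unfolding breaker_win_def using B c3 sub by (intro marks_separated_imp_breaker_win) auto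
  qed
qed

end
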